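(* Let $n\ge2$, let $R_w=R_{b_1}\cdots R_{b_\ell}\in\mathbf{Br}_n^+$ be a positive braid word in the greedy normal form, and let $R_a$ be a non-repeating braid. Then Thurston's automaton rewrites the word $R_a\cdot R_w$ to its greedy normal form, given by $$R_a\cdot R_w\to[R_a\asymp R_{b_1}]\,[(R_a\bowtie R_{b_1})\asymp R_{b_2}]\cdots[(((R_a\bowtie R_{b_1})\bowtie R_{b_2})\bowtie\cdots\bowtie R_{b_{\ell-1}})\asymp R_{b_\ell}]\,[(R_a\bowtie R_{b_1})\bowtie\cdots\bowtie R_{b_\ell}];$$ that is, the word of $\ell+1$ non-repeating braids on the right-hand side equals $R_aR_w$ in $\mathbf{Br}_n^+$ and is in the greedy normal form.
   Context: Permutations in $\mathbb{S}_n$ are multiplied from left to right: $(\pi_1\pi_2)(i)=\pi_2(\pi_1(i))$; $\varepsilon$ is the identity and $\omega$ is $i\mapsto n+1-i$. For $\pi\in\mathbb{S}_n$ put $R_\pi=\{(i,j): 1\le i<j\le n,\ \pi(i)>\pi(j)\}$. $\mathbf{Br}_n^+$ is the positive braid monoid with generators $\sigma_1,\dots,\sigma_{n-1}$ and the usual braid relations. A positive braid is non-repeating if any two of its strands cross at most once; $D$ is the set of non-repeating braids. The map sending a non-repeating braid to its permutation is a bijection $D\to\mathbb{S}_n$; the non-repeating braid with permutation $\pi$ is also denoted $R_\pi$, and in it the strands with top positions $i<j$ cross iff $(i,j)\in R_\pi$. $R_\varepsilon$ is the trivial braid. A product $BB'$ means $B$ first (above), then $B'$. Order $\pi_1\le\pi_2$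 iff $R_{\pi_1}\subseteq R_{\pi_2}$; this makes $\mathbb{S}_n$ a lattice with greatest lower bound $\wedge$, and one writes $R_{\pi_1}\wedge R_{\pi_2}:=R_{\pi_1\wedge\pi_2}$. Put $\pi R_\pi:=R_\pi^*:=R_{\pi^{-1}}$ and $\neg R_\pi:=R_{\pi\omega}$ (the complement of $R_\pi$ in the set of all pairs $i<j$). A word $R_{\pi_1}R_{\pi_2}\cdots R_{\pi_\ell}$ in non-repeating braids is in the (right) greedy normal form iff $\pi_iR_{\pi_i}\wedge\neg R_{\pi_{i+1}}=R_\varepsilon$ for all $1\le i<\ell$. Thurston's operations on $D$ are $$R_a\asymp R_b:=R_{a(a^{-1}\wedge b\omega)},\qquad R_a\bowtie R_b:=R_{(a^{-1}\wedge b\omega)^{-1}b}.$$ Iterated $\bowtie$ is bracketed to the left. Thurston's automaton rewrites a two-letter word by $R_aR_b\to(R_a\asymp R_b)(R_a\bowtie R_b)$. *)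

theory Defs
  imports "HOL-Combinatorics.Permutations" "HOL-Algebra.Group" "HOL-Algebra.Lattice"
begin

section \<open>Permutations and the weak order\<close>

text \<open>
  Elements of the symmetric group are functions \<open>\<pi>\<close> with \<open>\<pi> permutes {1..n}\<close>.
  Products are read from left to right, opposite to function composition.
\<close>

definition pmult :: "(nat \<Rightarrow> nat) \<Rightarrow> (nat \<Rightarrow> nat) \<Rightarrow> nat \<Rightarrow> nat"  (infixl \<open>\<cdot>\<close> 70)
  where "\<pi> \<cdot> \<rho> = \<rho> \<circ> \<pi>"

abbreviation pinv :: "(nat \<Rightarrow> nat) \<Rightarrow> nat \<Rightarrow> nat"
  where "pinv \<pi> \<equiv> inv_into UNIV \<pi>"

definition flip :: "nat \<Rightarrow> nat \<Rightarrow> nat"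
  where "flip n i = (if i \<in> {1..n} then n + 1 - i else i)"

definition inversions :: "nat \<Rightarrow> (nat \<Rightarrow> nat) \<Rightarrow> (nat \<times> nat) set"
  where "inversions n \<pi> = {(i, j). 1 \<le> i \<and> i < j \<and> j \<le> n \<and> \<pi> i > \<pi> j}"

definition weak_order :: "nat \<Rightarrow> (nat \<Rightarrow> nat) gorder"
  where "weak_order n =
    \<lparr>carrier = {\<pi>. \<pi> permutes {1..n}}, eq = (=),
     le = (\<lambda>\<pi> \<rho>. inversions n \<pi> \<subseteq> inversions n \<rho>)\<rparr>"

abbreviation pmeet :: "nat \<Rightarrow> (nat \<Rightarrow> nat) \<Rightarrow> (nat \<Rightarrow> nat) \<Rightarrow> nat \<Rightarrow> nat"
  where "pmeet n \<pi> \<rho> \<equiv> \<pi> \<sqinter>\<^bsub>weak_order n\<^esub> \<rho>"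


section \<open>The positive braid monoid\<close>

text \<open>
  The generators are the numbers in \<open>{1..<n}\<close>; a positive braid is a class of words
  in the generators modulo the congruence generated by the braid relations.
\<close>

inductive braid_step :: "nat list \<Rightarrow> nat list \<Rightarrow> bool"
  where
    far: "i + 2 \<le> j \<Longrightarrow> braid_step (u @ [i, j] @ v) (u @ [j, i] @ v)"
  | near: "braid_step (u @ [i, i + 1, i] @ v) (u @ [i + 1, i, i + 1] @ v)"

definition braid_cong :: "nat \<Rightarrow> (nat list \<times> nat list) set"
  where "braid_cong n =
    {(u, v). u \<in> lists {1..<n} \<and> v \<in> lists {1..<n} \<and> equivclp braid_step u v}"

type_synonym braid = "nat list set"

definition Br :: "nat \<Rightarrow> braid monoid"
  where "Br n =
    \<lparr>carrier = lists {1..<n} // braid_cong n,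
     mult = (\<lambda>X Y. braid_cong n `` {x @ y |x y. x \<in> X \<and> y \<in> Y}),
     one = braid_cong n `` {[]}\<rparr>"

text \<open>
  Words are read from top to bottom; the letter \<open>k\<close> crosses the strands which are
  currently at the positions \<open>k\<close> and \<open>k + 1\<close>. A strand is named by its top position,
  and \<open>word_perm\<close> sends it to its bottom position.
\<close>

primrec word_perm :: "nat list \<Rightarrow> nat \<Rightarrow> nat"
  where
    "word_perm [] = id"
  | "word_perm (k # w) = transpose k (k + 1) \<cdot> word_perm w"

primrec crossings :: "nat list \<Rightarrow> nat \<Rightarrow> nat \<Rightarrow> nat"
  where
    "crossings [] i j = 0"
  | "crossings (k # w) i j = (if {i, j} = {k, k + 1} then 1 else 0)
       + crossings w (transpose k (k + 1) i) (transpose k (k + 1) j)"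

definition braid_perm :: "braid \<Rightarrow> nat \<Rightarrow> nat"
  where "braid_perm X = the_elem (word_perm ` X)"

definition nonrepeating :: "nat \<Rightarrow> braid set"
  where "nonrepeating n =
    {X \<in> carrier (Br n). \<forall>w\<in>X. \<forall>i\<in>{1..n}. \<forall>j\<in>{1..n}. i \<noteq> j \<longrightarrow> crossings w i j \<le> 1}"

text \<open>
  The permutation and the numbers of crossings do not depend on the word chosen to
  represent a braid, and a non-repeating braid is determined by its permutation;
  hence \<open>the_elem\<close> above and \<open>THE\<close> below pick unique objects.
\<close>

definition nr_braid :: "nat \<Rightarrow> (nat \<Rightarrow> nat) \<Rightarrow> braid"
  where "nr_braid n \<pi> = (THE X. X \<in> nonrepeating n \<and> braid_perm X = \<pi>)"

definition word_braid :: "nat \<Rightarrow> braid list \<Rightarrow> braid"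
  where "word_braid n Xs = foldr (mult (Br n)) Xs (one (Br n))"


section \<open>Operations on non-repeating braids\<close>

definition braid_meet :: "nat \<Rightarrow> braid \<Rightarrow> braid \<Rightarrow> braid"
  where "braid_meet n X Y = nr_braid n (pmeet n (braid_perm X) (braid_perm Y))"

definition star :: "nat \<Rightarrow> braid \<Rightarrow> braid"
  where "star n X = nr_braid n (pinv (braid_perm X))"

definition neg :: "nat \<Rightarrow> braid \<Rightarrow> braid"
  where "neg n X = nr_braid n (braid_perm X \<cdot> flip n)"

definition greedy_normal_form :: "nat \<Rightarrow> braid list \<Rightarrow> bool"
  where "greedy_normal_form n Xs \<longleftrightarrow>
    set Xs \<subseteq> nonrepeating n \<and>
    (\<forall>i. i + 1 < length Xs \<longrightarrow> braid_meet n (star n (Xs ! i)) (neg n (Xs ! (i + 1))) = nr_braid n id)"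

definition th_asymp :: "nat \<Rightarrow> braid \<Rightarrow> braid \<Rightarrow> braid"
  where "th_asymp n X Y =
    (let a = braid_perm X; b = braid_perm Y
     in nr_braid n (a \<cdot> pmeet n (pinv a) (b \<cdot> flip n)))"

definition th_bowtie :: "nat \<Rightarrow> braid \<Rightarrow> braid \<Rightarrow> braid"
  where "th_bowtie n X Y =
    (let a = braid_perm X; b = braid_perm Y
     in nr_braid n (pinv (pmeet n (pinv a) (b \<cdot> flip n)) \<cdot> b))"

inductive thurston_step :: "nat \<Rightarrow> braid list \<Rightarrow> braid list \<Rightarrow> bool" for n
  where
    "X \<in> nonrepeating n \<Longrightarrow> Y \<in> nonrepeating n \<Longrightarrow>
     thurston_step n (Us @ [X, Y] @ Vs) (Us @ [th_asymp n X Y, th_bowtie n X Y] @ Vs)"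

end

theory Submission imports Defs begin

text \<open>
  A crossing at the bottom of \<open>R\<^sub>a\<close> may be moved down onto the top of \<open>R\<^sub>b\<close> as long as the two
  strands do not cross in \<open>R\<^sub>b\<close>. The largest part that can be moved at once is \<open>c = a\<inverse> \<and> b\<omega>\<close>;
  this is \<open>transfer\<close> below. As \<open>c\<close> is a top part of \<open>a\<inverse>\<close>, which is \<open>a\<close> upside down,
  \<open>R\<^sub>a = R\<^bsub>ac\<^esub> R\<^bsub>c\<inverse>\<^esub>\<close>; it is disjoint from the crossings of \<open>b\<close>, so
  \<open>R\<^bsub>c\<inverse>\<^esub> R\<^sub>b = R\<^bsub>c\<inverse>b\<^esub>\<close>. Hence a step of the automaton replaces \<open>R\<^sub>a R\<^sub>b\<close> by an equal braid
  (\<open>nr_braid_mult_asymp_bowtie\<close>), and by maximality of \<open>c\<close> nothing more can be moved: the result is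
  greedy (\<open>normal_pair_asymp_bowtie\<close>).

  Sweeping over \<open>b\<^sub>1, b\<^sub>2, \<dots>\<close> produces the factors \<open>x\<^sub>i = S\<^bsub>i-1\<^esub> \<asymp> b\<^sub>i\<close> and the carried factor
  \<open>S\<^sub>i = S\<^bsub>i-1\<^esub> \<bowtie> b\<^sub>i\<close>. What has to be seen is that a later step does not spoil an earlier one, that is,
  that \<open>x\<^sub>i\<close> and \<open>x\<^bsub>i+1\<^esub>\<close> form a greedy pair although only \<open>x\<^sub>i\<close> and \<open>S\<^sub>i\<close> did before
  (\<open>domino_rule\<close>). Here \<open>S\<^sub>i\<close> ends both in \<open>b\<^sub>i\<close> and in the part \<open>c\<inverse>\<close> that the next step removes from
  it. If the pair \<open>x\<^sub>i, x\<^bsub>i+1\<^esub>\<close> were not greedy, there would be two strands, adjacent at the top of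
  \<open>S\<^sub>i\<close>, that cross in the part \<open>b\<^sub>i\<close> as well as in the part \<open>c\<inverse>\<close>. Then some two strands which are adjacent
  at the bottom also cross in both parts (\<open>common_descent\<close>). As \<open>c\<close> has no crossing in common with
  \<open>b\<^bsub>i+1\<^esub>\<close>, this crossing of \<open>b\<^sub>i\<close> could have been moved onto \<open>b\<^bsub>i+1\<^esub>\<close>, against the greediness of the
  given word.

  Two classical facts underlie this: the weak order has meets (\<open>weak_order_meet_exists\<close>), and words
  without repeated crossings that have the same permutation are related by braid relations alone
  (\<open>reduced_words_braid_equiv\<close>, Matsumoto's theorem for the symmetric group), so that \<open>nr_braid\<close>
  really is the non-repeating braid of a permutation.
\<close>

section \<open>The weak order\<close>

lemma permutes_bounds:
  assumes "\<pi> permutes {1..n}" "i \<in> {1..n}"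
  shows "\<pi> i \<in> {1..n}"
  using assms permutes_in_image by metis

lemma pmult_permutes:
  assumes "\<pi> permutes S" "\<rho> permutes S"
  shows "\<pi> \<cdot> \<rho> permutes S"
  using assms by (simp add: pmult_def permutes_compose)

lemma pmult_apply [simp]: "(\<pi> \<cdot> \<rho>) i = \<rho> (\<pi> i)"
  by (simp add: pmult_def)

lemma pmult_assoc: "\<pi> \<cdot> \<rho> \<cdot> \<tau> = \<pi> \<cdot> (\<rho> \<cdot> \<tau>)"
  by (simp add: pmult_def comp_assoc)

lemma pinv_pmult:
  assumes "\<pi> permutes S" "\<rho> permutes S"
  shows "pinv (\<pi> \<cdot> \<rho>) = pinv \<rho> \<cdot> pinv \<pi>"
  unfolding pmult_def by (rule o_inv_distrib) (use assms permutes_bij in blast)+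

lemma permutes_eq_iff:
  assumes "\<pi> permutes S"
  shows "\<pi> i = \<pi> j \<longleftrightarrow> i = j"
  using permutes_inj[OF assms] by (simp add: inj_eq)

lemma inversions_iff:
  "(i, j) \<in> inversions n \<pi> \<longleftrightarrow> 1 \<le> i \<and> i < j \<and> j \<le> n \<and> \<pi> j < \<pi> i"
  by (simp add: inversions_def)

lemma not_inversion_less:
  assumes "\<pi> permutes {1..n}" "1 \<le> i" "i < j" "j \<le> n" "(i, j) \<notin> inversions n \<pi>"
  shows "\<pi> i < \<pi> j"
proof -
  have "\<pi> i \<noteq> \<pi> j" using assms(3) permutes_eq_iff[OF assms(1)] by auto
  then show ?thesis using assms(2-) by (auto simp: inversions_iff)
qed

lemma permutes_eq_card:
  assumes "\<pi> permutes {1..n}" "i \<in> {1..n}"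
  shows "\<pi> i = card {j \<in> {1..n}. \<pi> j \<le> \<pi> i}"
proof -
  have "\<pi> ` {j \<in> {1..n}. \<pi> j \<le> \<pi> i} = {1..\<pi> i}"
  proof (intro equalityI subsetI)
    fix k assume "k \<in> {1..\<pi> i}"
    moreover have "\<pi> i \<le> n" using permutes_bounds[OF assms] by simp
    ultimately have "k \<in> \<pi> ` {1..n}" using permutes_image[OF assms(1)] by simp
    then show "k \<in> \<pi> ` {j \<in> {1..n}. \<pi> j \<le> \<pi> i}" using \<open>k \<in> {1..\<pi> i}\<close> by auto
  qed (use permutes_bounds[OF assms(1)] in fastforce)
  moreover have "inj_on \<pi> {j \<in> {1..n}. \<pi> j \<le> \<pi> i}"
    using permutes_inj_on[OF assms(1)] by blast
  ultimately show ?thesis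
    by (metis card_image card_atLeastAtMost diff_Suc_1)
qed

text \<open>
  The inversions tell for any two arguments which of the values is smaller, hence the rank of each
  value; and on \<open>{1..n}\<close> the rank is the value.
\<close>

lemma inversions_inject:
  assumes "\<pi> permutes {1..n}" "\<rho> permutes {1..n}" "inversions n \<pi> = inversions n \<rho>"
  shows "\<pi> = \<rho>"
proof
  fix i
  show "\<pi> i = \<rho> i"
  proof (cases "i \<in> {1..n}")
    case True
    have "\<pi> j \<le> \<pi> i \<longleftrightarrow> \<rho> j \<le> \<rho> i" if "j \<in> {1..n}" for j
    proof -
      have *: "(k, l) \<in> inversions n \<pi> \<longleftrightarrow> (k, l) \<in> inversions n \<rho>" for k l
        using assms(3) by simp
      consider "j < i" | "j = i" | "i < j" by linarith
      then show ?thesis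
        using *[of i j] *[of j i] that True
          permutes_eq_iff[OF assms(1), of i j] permutes_eq_iff[OF assms(2), of i j]
        by cases (auto simp: inversions_iff)
    qed
    then have "{j \<in> {1..n}. \<pi> j \<le> \<pi> i} = {j \<in> {1..n}. \<rho> j \<le> \<rho> i}" by blast
    then show ?thesis using permutes_eq_card[OF assms(1) True] permutes_eq_card[OF assms(2) True] by simp
  next
    case False
    then show ?thesis using assms(1,2) by (simp add: permutes_not_in)
  qed
qed

lemma inversion_adjacent:
  fixes f :: "nat \<Rightarrow> nat"
  assumes "i < j" "f j < f i"
  shows "\<exists>r. i \<le> r \<and> r < j \<and> f (Suc r) < f r"
proof (rule ccontr)
  assume "\<not> ?thesis"
  then have *: "i \<le> r \<Longrightarrow> r < j \<Longrightarrow> f r \<le> f (Suc r)" for r by force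
  have "k \<le> j \<Longrightarrow> f i \<le> f k" if "i \<le> k" for k
    using that by (induction k rule: dec_induct) (use * in \<open>auto intro: le_trans\<close>)
  from this[of j] show False using assms by simp
qed

lemma inversions_empty_imp_id:
  assumes "\<pi> permutes {1..n}" "inversions n \<pi> = {}"
  shows "\<pi> = id"
  by (rule inversions_inject[OF assms(1) permutes_id]) (use assms(2) in \<open>auto simp: inversions_def\<close>)

lemma no_descent_imp_id:
  assumes "\<pi> permutes {1..n}" "\<And>r. r \<in> {1..<n} \<Longrightarrow> \<not> \<pi> (Suc r) < \<pi> r"
  shows "\<pi> = id"
proof (rule inversions_empty_imp_id[OF assms(1)], rule ccontr)
  assume "inversions n \<pi> \<noteq> {}"
  then obtain i j where "(i, j) \<in> inversions n \<pi>" by auto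
  then have ij: "1 \<le> i" "i < j" "j \<le> n" "\<pi> j < \<pi> i" by (auto simp: inversions_iff)
  obtain r where "i \<le> r" "r < j" "\<pi> (Suc r) < \<pi> r"
    using inversion_adjacent[OF ij(2,4)] by blast
  then show False using assms(2)[of r] ij by auto
qed

text \<open>
  The permutation sends each element to its rank. This is how a permutation is recovered from a
  prospective set of inversions.
\<close>

lemma permutation_of_linear_order:
  fixes n :: nat
  assumes irrefl: "\<And>x. \<not> before x x"
    and trans: "\<And>x y z. x \<in> {1..n} \<Longrightarrow> y \<in> {1..n} \<Longrightarrow> z \<in> {1..n} \<Longrightarrow>
      before x y \<Longrightarrow> before y z \<Longrightarrow> before x z"
    and total: "\<And>x y. x \<in> {1..n} \<Longrightarrow> y \<in> {1..n} \<Longrightarrow> x \<noteq> y \<Longrightarrow> before x y \<or> before y x"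
  shows "\<exists>\<mu>. \<mu> permutes {1..n} \<and> (\<forall>x\<in>{1..n}. \<forall>y\<in>{1..n}. \<mu> x < \<mu> y \<longleftrightarrow> before x y)"
proof -
  define D where "D x = {z \<in> {1..n}. before z x}" for x
  define \<mu> where "\<mu> x = (if x \<in> {1..n} then Suc (card (D x)) else x)" for x
  have mono: "\<mu> x < \<mu> y" if "x \<in> {1..n}" "y \<in> {1..n}" "before x y" for x y
  proof -
    have "D x \<subset> D y" using that irrefl trans unfolding D_def by blast
    then have "card (D x) < card (D y)" by (intro psubset_card_mono) (auto simp: D_def)
    then show ?thesis using that by (simp add: \<mu>_def)
  qed
  have iff: "\<mu> x < \<mu> y \<longleftrightarrow> before x y" if "x \<in> {1..n}" "y \<in> {1..n}" for x y
    using that mono[of x y] mono[of y x] total[of x y] by force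
  have "inj_on \<mu> {1..n}"
    using mono total by (intro inj_onI) (metis less_irrefl)
  moreover have "\<mu> ` {1..n} \<subseteq> {1..n}"
  proof clarify
    fix x assume x: "x \<in> {1..n}"
    have "D x \<subset> {1..n}" using x irrefl unfolding D_def by blast
    then have "card (D x) < n" using psubset_card_mono[of "{1..n}" "D x"] by simp
    then show "\<mu> x \<in> {1..n}" using x by (simp add: \<mu>_def)
  qed
  ultimately have "bij_betw \<mu> {1..n} {1..n}"
    by (simp add: bij_betw_def endo_inj_surj)
  then have "\<mu> permutes {1..n}" by (rule bij_imp_permutes) (auto simp: \<mu>_def)
  then show ?thesis using iff by blast
qed

text \<open>
  The meet inverts as many pairs as possible, so its set \<open>T\<close> of non-inversions should be as small as
  possible. It must contain the non-inversions \<open>N\<close> of both permutations and, like any set of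
  non-inversions, be transitive; this suggests \<open>T = N\<^sup>+\<close>. For \<open>T\<close> to come from a permutation its complement has
  to be transitive too. That property passes from \<open>N\<close> to \<open>N\<^sup>+\<close>: a point between the ends of a
  chain is a member of the chain or lies inside one of its links.
\<close>

lemma weak_order_meet_exists:
  assumes \<pi>: "\<pi> permutes {1..n}" and \<rho>: "\<rho> permutes {1..n}"
  shows "\<exists>\<mu>. \<mu> permutes {1..n} \<and> inversions n \<mu> \<subseteq> inversions n \<pi> \<and> inversions n \<mu> \<subseteq> inversions n \<rho>
    \<and> (\<forall>\<tau>. \<tau> permutes {1..n} \<longrightarrow> inversions n \<tau> \<subseteq> inversions n \<pi> \<longrightarrow> inversions n \<tau> \<subseteq> inversions n \<rho>
         \<longrightarrow> inversions n \<tau> \<subseteq> inversions n \<mu>)"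
proof -
  define N where "N = {(i, j). 1 \<le> i \<and> i < j \<and> j \<le> n \<and> (\<pi> i < \<pi> j \<or> \<rho> i < \<rho> j)}"
  define T where "T = N\<^sup>+"
  have T_less: "x < y" if "(x, y) \<in> T" for x y
    using that unfolding T_def by (induction rule: trancl_induct) (auto simp: N_def)
  have T_trans: "(x, z) \<in> T" if "(x, y) \<in> T" "(y, z) \<in> T" for x y z
    using that unfolding T_def by (rule trancl_trans)
  have N_split: "(x, z) \<in> N \<or> (z, y) \<in> N" if "(x, y) \<in> N" "x < z" "z < y" for x y z
    using that unfolding N_def by auto
  have T_split: "(x, z) \<in> T \<or> (z, y) \<in> T" if "(x, y) \<in> T" "x < z" "z < y" for x y z
    using that unfolding T_def
  proof (induction rule: trancl_induct)
    case (base y)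
    then show ?case using N_split by blast
  next
    case (step y w)
    consider "z < y" | "z = y" | "y < z" by linarith
    then show ?case
    proof cases
      case 3
      then show ?thesis using N_split[OF step(2) 3] step by (meson r_into_trancl' trancl.trancl_into_trancl)
    qed (use step in \<open>auto intro: trancl.trancl_into_trancl\<close>)
  qed
  define before where "before x y \<longleftrightarrow> (x < y \<and> (x, y) \<in> T) \<or> (y < x \<and> (y, x) \<notin> T)" for x y
  have trans: "before x z" if "before x y" "before y z" for x y z
    using that T_trans[of x y z] T_trans[of z x y] T_trans[of y z x]
      T_split[of x y z] T_split[of y z x] T_split[of z x y]
    unfolding before_def by (cases x z rule: linorder_cases) auto
  have "\<exists>\<mu>. \<mu> permutes {1..n} \<and> (\<forall>x\<in>{1..n}. \<forall>y\<in>{1..n}. \<mu> x < \<mu> y \<longleftrightarrow> before x y)"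
    by (rule permutation_of_linear_order) (use trans in \<open>auto simp: before_def\<close>)
  then obtain \<mu> where \<mu>: "\<mu> permutes {1..n}"
    and \<mu>_iff: "\<And>x y. x \<in> {1..n} \<Longrightarrow> y \<in> {1..n} \<Longrightarrow> \<mu> x < \<mu> y \<longleftrightarrow> before x y" by blast
  have \<mu>_inv: "(i, j) \<in> inversions n \<mu> \<longleftrightarrow> 1 \<le> i \<and> i < j \<and> j \<le> n \<and> (i, j) \<notin> T" for i j
    using \<mu>_iff[of j i] by (auto simp: inversions_iff before_def)
  have lower: "(i, j) \<in> inversions n \<pi> \<and> (i, j) \<in> inversions n \<rho>" if "(i, j) \<in> inversions n \<mu>" for i j
  proof -
    have *: "1 \<le> i" "i < j" "j \<le> n" "(i, j) \<notin> N" using that by (auto simp: \<mu>_inv T_def)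
    then show ?thesis
      using not_inversion_less[OF \<pi> *(1-3)] not_inversion_less[OF \<rho> *(1-3)] by (auto simp: N_def)
  qed
  have greatest: "inversions n \<tau> \<subseteq> inversions n \<mu>"
    if \<tau>: "\<tau> permutes {1..n}" "inversions n \<tau> \<subseteq> inversions n \<pi>" "inversions n \<tau> \<subseteq> inversions n \<rho>" for \<tau>
  proof -
    have N_less: "\<tau> i < \<tau> j" if "(i, j) \<in> N" for i j
    proof (rule not_inversion_less[OF \<tau>(1)])
      show "(i, j) \<notin> inversions n \<tau>"
      proof
        assume "(i, j) \<in> inversions n \<tau>"
        then have "(i, j) \<in> inversions n \<pi>" "(i, j) \<in> inversions n \<rho>" using \<tau>(2,3) by blast+
        then show False using that by (auto simp: N_def inversions_iff)
      qed
    qed (use that in \<open>auto simp: N_def\<close>)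
    have T_less': "\<tau> i < \<tau> j" if "(i, j) \<in> T" for i j
      using that unfolding T_def
      by (induction rule: trancl_induct) (use N_less less_trans in blast)+
    show ?thesis
    proof clarify
      fix i j assume "(i, j) \<in> inversions n \<tau>"
      then show "(i, j) \<in> inversions n \<mu>" using T_less'[of i j] unfolding \<mu>_inv by (auto simp: inversions_iff)
    qed
  qed
  show ?thesis using \<mu> lower greatest by (intro exI[of _ \<mu>]) auto
qed

lemma greatest_weak_order_iff:
  assumes "\<pi> permutes {1..n}" "\<rho> permutes {1..n}"
  shows "greatest (weak_order n) \<mu> (Lower (weak_order n) {\<pi>, \<rho>}) \<longleftrightarrow>
    \<mu> permutes {1..n} \<and> inversions n \<mu> \<subseteq> inversions n \<pi> \<and> inversions n \<mu> \<subseteq> inversions n \<rho>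
    \<and> (\<forall>\<tau>. \<tau> permutes {1..n} \<longrightarrow> inversions n \<tau> \<subseteq> inversions n \<pi> \<longrightarrow> inversions n \<tau> \<subseteq> inversions n \<rho>
         \<longrightarrow> inversions n \<tau> \<subseteq> inversions n \<mu>)"
proof -
  have "Lower (weak_order n) {\<pi>, \<rho>} = {\<tau>. \<tau> permutes {1..n} \<and>
      inversions n \<tau> \<subseteq> inversions n \<pi> \<and> inversions n \<tau> \<subseteq> inversions n \<rho>}"
    using assms unfolding Lower_def weak_order_def by auto
  then show ?thesis unfolding greatest_def by (simp add: weak_order_def Ball_def Collect_mono_iff imp_conjL)
qed

lemma pmeet_greatest:
  assumes "\<pi> permutes {1..n}" "\<rho> permutes {1..n}"
  shows "greatest (weak_order n) (pmeet n \<pi> \<rho>) (Lower (weak_order n) {\<pi>, \<rho>})"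
  using someI_ex[of "\<lambda>\<mu>. greatest (weak_order n) \<mu> (Lower (weak_order n) {\<pi>, \<rho>})"]
    weak_order_meet_exists[OF assms] greatest_weak_order_iff[OF assms]
  unfolding meet_def inf_def by blast

lemma
  assumes "\<pi> permutes {1..n}" "\<rho> permutes {1..n}"
  shows pmeet_permutes: "pmeet n \<pi> \<rho> permutes {1..n}"
    and pmeet_lower1: "inversions n (pmeet n \<pi> \<rho>) \<subseteq> inversions n \<pi>"
    and pmeet_lower2: "inversions n (pmeet n \<pi> \<rho>) \<subseteq> inversions n \<rho>"
    and pmeet_upper: "\<tau> permutes {1..n} \<Longrightarrow> inversions n \<tau> \<subseteq> inversions n \<pi> \<Longrightarrow>
      inversions n \<tau> \<subseteq> inversions n \<rho> \<Longrightarrow> inversions n \<tau> \<subseteq> inversions n (pmeet n \<pi> \<rho>)"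
  using pmeet_greatest[OF assms] unfolding greatest_weak_order_iff[OF assms] by blast+

lemma flip_permutes: "flip n permutes {1..n}"
proof (rule bij_imp_permutes)
  show "bij_betw (flip n) {1..n} {1..n}"
    by (rule bij_betwI[where g = "flip n"]) (auto simp: flip_def)
qed (auto simp: flip_def)

lemma inversions_flip:
  assumes "b permutes {1..n}"
  shows "(i, j) \<in> inversions n (b \<cdot> flip n) \<longleftrightarrow> 1 \<le> i \<and> i < j \<and> j \<le> n \<and> b i < b j"
proof (cases "1 \<le> i \<and> i < j \<and> j \<le> n")
  case True
  then have "b i \<in> {1..n}" "b j \<in> {1..n}" using permutes_bounds[OF assms] by auto
  then show ?thesis using True by (auto simp: inversions_iff flip_def)
qed (auto simp: inversions_iff)

lemma adjacent_transposition_permutes: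
  "k \<in> {1..<n} \<Longrightarrow> transpose k (Suc k) permutes {1..n}"
  by (rule permutes_swap_id) auto

lemma transpose_less_iff:
  "i \<noteq> j \<Longrightarrow> transpose k (Suc k) i < transpose k (Suc k) j \<longleftrightarrow> (if {i, j} = {k, Suc k} then j < i else i < j)"
  by (auto simp: transpose_def doubleton_eq_iff)

section \<open>Normal pairs and the domino rule\<close>

text \<open>
  Greediness read off from adjacent positions: two strands that cross in \<open>x\<close> and leave it side by
  side have to cross in \<open>y\<close> as well, so that their crossing cannot be moved from \<open>x\<close> to \<open>y\<close>.
\<close>

definition normal_pair :: "nat \<Rightarrow> (nat \<Rightarrow> nat) \<Rightarrow> (nat \<Rightarrow> nat) \<Rightarrow> bool"
  where "normal_pair n x y \<longleftrightarrow> (\<forall>r\<in>{1..<n}. pinv x (Suc r) < pinv x r \<longrightarrow> y (Suc r) < y r)"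

text \<open>
  A non-identity permutation has an adjacent inversion, and an adjacent inversion of both arguments
  gives an adjacent transposition below both. So a meet is trivial exactly when its two
  arguments have no adjacent inversion in common.
\<close>

lemma normal_pair_iff_pmeet:
  assumes x: "x permutes {1..n}" and y: "y permutes {1..n}"
  shows "normal_pair n x y \<longleftrightarrow> pmeet n (pinv x) (y \<cdot> flip n) = id"
proof -
  let ?m = "pmeet n (pinv x) (y \<cdot> flip n)"
  note p = permutes_inv[OF x] pmult_permutes[OF y flip_permutes]
  show ?thesis
  proof
    assume normal: "normal_pair n x y"
    show "?m = id"
    proof (rule no_descent_imp_id[OF pmeet_permutes[OF p]])
      fix r assume r: "r \<in> {1..<n}"
      show "\<not> ?m (Suc r) < ?m r"
      proof
        assume "?m (Suc r) < ?m r"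
        then have "(r, Suc r) \<in> inversions n ?m" using r by (auto simp: inversions_iff)
        then have "(r, Suc r) \<in> inversions n (pinv x)" "(r, Suc r) \<in> inversions n (y \<cdot> flip n)"
          using pmeet_lower1[OF p] pmeet_lower2[OF p] by auto
        then show False using normal r unfolding normal_pair_def inversions_flip[OF y]
          by (auto simp: inversions_iff)
      qed
    qed
  next
    assume m: "?m = id"
    show "normal_pair n x y" unfolding normal_pair_def
    proof (intro ballI impI, rule ccontr)
      fix r assume r: "r \<in> {1..<n}" "pinv x (Suc r) < pinv x r" "\<not> y (Suc r) < y r"
      let ?s = "transpose r (Suc r)"
      have s: "inversions n ?s = {(r, Suc r)}"
        using r(1) by (auto simp: inversions_iff transpose_less_iff doubleton_eq_iff split: if_splits)
      have "y r < y (Suc r)" using r(3) permutes_eq_iff[OF y, of r "Suc r"] by auto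
      then have "inversions n ?s \<subseteq> inversions n ?m"
        using pmeet_upper[OF p adjacent_transposition_permutes[OF r(1)]] r(1,2)
        by (auto simp: s inversions_flip[OF y]) (auto simp: inversions_iff)
      then show False using m s by (auto simp: inversions_iff)
    qed
  qed
qed

text \<open>
  The strands of \<open>transfer n a b\<close> are named by their positions between \<open>R\<^sub>a\<close> and \<open>R\<^sub>b\<close>; it collects the
  crossings which Thurston's automaton moves from the bottom of \<open>R\<^sub>a\<close> to the top of \<open>R\<^sub>b\<close>.
\<close>

definition transfer :: "nat \<Rightarrow> (nat \<Rightarrow> nat) \<Rightarrow> (nat \<Rightarrow> nat) \<Rightarrow> nat \<Rightarrow> nat"
  where "transfer n a b = pmeet n (pinv a) (b \<cdot> flip n)"

lemma
  assumes "a permutes {1..n}" "b permutes {1..n}"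
  shows transfer_permutes: "transfer n a b permutes {1..n}"
    and transfer_inversions_left: "inversions n (transfer n a b) \<subseteq> inversions n (pinv a)"
    and transfer_inversions_right: "inversions n (transfer n a b) \<inter> inversions n b = {}"
    and transfer_upper: "\<tau> permutes {1..n} \<Longrightarrow> inversions n \<tau> \<subseteq> inversions n (pinv a) \<Longrightarrow>
      inversions n \<tau> \<inter> inversions n b = {} \<Longrightarrow> inversions n \<tau> \<subseteq> inversions n (transfer n a b)"
proof -
  note p = permutes_inv[OF assms(1)] pmult_permutes[OF assms(2) flip_permutes]
  have *: "inversions n \<tau> \<subseteq> inversions n (b \<cdot> flip n) \<longleftrightarrow> inversions n \<tau> \<inter> inversions n b = {}" for \<tau>
  proof -
    have "(i, j) \<in> inversions n (b \<cdot> flip n) \<longleftrightarrow> (i, j) \<notin> inversions n b"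
      if "(i, j) \<in> inversions n \<tau>" for i j
      using that not_inversion_less[OF assms(2), of i j] unfolding inversions_flip[OF assms(2)]
      by (auto simp: inversions_iff)
    then show ?thesis by auto
  qed
  show "transfer n a b permutes {1..n}" "inversions n (transfer n a b) \<subseteq> inversions n (pinv a)"
    unfolding transfer_def by (rule pmeet_permutes[OF p], rule pmeet_lower1[OF p])
  show "inversions n (transfer n a b) \<inter> inversions n b = {}"
    using pmeet_lower2[OF p] unfolding transfer_def * .
  show "\<tau> permutes {1..n} \<Longrightarrow> inversions n \<tau> \<subseteq> inversions n (pinv a) \<Longrightarrow>
      inversions n \<tau> \<inter> inversions n b = {} \<Longrightarrow> inversions n \<tau> \<subseteq> inversions n (transfer n a b)"
    using pmeet_upper[OF p] unfolding transfer_def * .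
qed

definition perm_asymp :: "nat \<Rightarrow> (nat \<Rightarrow> nat) \<Rightarrow> (nat \<Rightarrow> nat) \<Rightarrow> nat \<Rightarrow> nat"
  where "perm_asymp n a b = a \<cdot> transfer n a b"

definition perm_bowtie :: "nat \<Rightarrow> (nat \<Rightarrow> nat) \<Rightarrow> (nat \<Rightarrow> nat) \<Rightarrow> nat \<Rightarrow> nat"
  where "perm_bowtie n a b = pinv (transfer n a b) \<cdot> b"

lemma
  assumes "a permutes {1..n}" "b permutes {1..n}"
  shows perm_asymp_permutes: "perm_asymp n a b permutes {1..n}"
    and perm_bowtie_permutes: "perm_bowtie n a b permutes {1..n}"
  unfolding perm_asymp_def perm_bowtie_def
  using assms transfer_permutes[OF assms] by (auto intro: pmult_permutes permutes_inv)

text \<open>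
  The remainder \<open>a \<asymp> b\<close> and the inverse of the moved part make up the non-repeating \<open>a\<close>, so two strands
  that cross in one of them do not cross in the other.
\<close>

lemma asymp_descent_transfer:
  assumes a: "a permutes {1..n}" and b: "b permutes {1..n}" and r: "r \<in> {1..<n}"
    and desc: "pinv (perm_asymp n a b) (Suc r) < pinv (perm_asymp n a b) r"
  shows "pinv (transfer n a b) r < pinv (transfer n a b) (Suc r)"
proof (rule ccontr)
  let ?c = "transfer n a b"
  note c = transfer_permutes[OF a b]
  let ?p = "pinv ?c r" and ?q = "pinv ?c (Suc r)"
  have bounds: "?p \<in> {1..n}" "?q \<in> {1..n}"
    by (rule permutes_bounds[OF permutes_inv[OF c]], use r in simp)+
  assume "\<not> ?thesis"
  then have "?q < ?p" using permutes_eq_iff[OF permutes_inv[OF c], of r "Suc r"] by auto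
  then have "(?q, ?p) \<in> inversions n ?c"
    using bounds by (auto simp: inversions_iff permutes_inverses[OF c])
  then have "(?q, ?p) \<in> inversions n (pinv a)" using transfer_inversions_left[OF a b] by blast
  then show False using desc by (simp add: perm_asymp_def pinv_pmult[OF a c] inversions_iff)
qed

text \<open>
  A crossing that could still be moved down could be appended to the transferred part \<open>c\<close>, giving
  the element \<open>c s\<close> with one more inversion that is still a lower bound; but \<open>c\<close> is the greatest one.
\<close>

lemma normal_pair_asymp_bowtie:
  assumes a: "a permutes {1..n}" and b: "b permutes {1..n}"
  shows "normal_pair n (perm_asymp n a b) (perm_bowtie n a b)"
  unfolding normal_pair_def
proof (intro ballI impI, rule ccontr)
  let ?c = "transfer n a b"
  note c = transfer_permutes[OF a b]
  fix r assume r: "r \<in> {1..<n}" and desc: "pinv (perm_asymp n a b) (Suc r) < pinv (perm_asymp n a b) r"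
    and asc: "\<not> perm_bowtie n a b (Suc r) < perm_bowtie n a b r"
  define p q where "p = pinv ?c r" and "q = pinv ?c (Suc r)"
  have cp: "?c p = r" "?c q = Suc r" by (simp_all add: p_def q_def permutes_inverses[OF c])
  have "p < q" using asymp_descent_transfer[OF a b r desc] by (simp add: p_def q_def)
  have bounds: "p \<in> {1..n}" "q \<in> {1..n}"
    unfolding p_def q_def by (rule permutes_bounds[OF permutes_inv[OF c]], use r in simp)+
  let ?d = "?c \<cdot> transpose r (Suc r)"
  have d: "?d permutes {1..n}" by (intro pmult_permutes c adjacent_transposition_permutes r)
  have inv_d: "inversions n ?d = insert (p, q) (inversions n ?c)"
  proof -
    have "(i, j) \<in> inversions n ?d \<longleftrightarrow> (i, j) = (p, q) \<or> (i, j) \<in> inversions n ?c" for i j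
    proof (cases "i < j")
      case True
      have 1: "{?c j, ?c i} = {r, Suc r} \<longleftrightarrow> (i, j) = (p, q)"
        using inj_image_eq_iff[OF permutes_inj[OF c], of "{j, i}" "{p, q}"] True \<open>p < q\<close> cp
        by (auto simp: doubleton_eq_iff)
      have "?c j \<noteq> ?c i" using True permutes_eq_iff[OF c] by auto
      from transpose_less_iff[OF this, of r] show ?thesis
        using True 1 bounds cp by (auto simp: inversions_iff)
    qed (use \<open>p < q\<close> in \<open>auto simp: inversions_iff\<close>)
    then show ?thesis by auto
  qed
  have "pinv a q < pinv a p"
    using desc by (simp add: perm_asymp_def pinv_pmult[OF a c] p_def q_def)
  then have "(p, q) \<in> inversions n (pinv a)"
    using bounds \<open>p < q\<close> by (auto simp: inversions_iff)
  moreover have "(p, q) \<notin> inversions n b"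
    using asc by (simp add: perm_bowtie_def p_def q_def inversions_iff)
  ultimately have "inversions n ?d \<subseteq> inversions n ?c"
    using transfer_upper[OF a b d] transfer_inversions_left[OF a b] transfer_inversions_right[OF a b]
    unfolding inv_d by blast
  then show False using inv_d cp by (auto simp: inversions_iff)
qed

text \<open>
  Here \<open>\<beta>\<close> and \<open>\<gamma>\<close> are two top parts of \<open>\<sigma>\<close> that share an inversion \<open>(p, q)\<close> whose values under
  \<open>\<sigma>\<close> are neighbours. Every position strictly between \<open>p\<close> and \<open>q\<close> then has a \<open>\<sigma>\<close>-value either below both
  neighbours or above both. Take the last position \<open>r\<close> with a value above, \<open>p\<close> included. The pairs \<open>(p, r)\<close> and
  \<open>(r + 1, q)\<close> are not inverted by \<open>\<sigma>\<close>, hence not by its parts, and with the inversion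
  \<open>(p, q)\<close> this forces \<open>(r, r + 1)\<close> to be inverted by both parts.

  Without the hypothesis on the values, a common inversion need not yield a common adjacent one.
\<close>

lemma common_descent:
  assumes \<beta>: "\<beta> permutes {1..n}" "inversions n \<beta> \<subseteq> inversions n \<sigma>" "(p, q) \<in> inversions n \<beta>"
    and \<gamma>: "\<gamma> permutes {1..n}" "inversions n \<gamma> \<subseteq> inversions n \<sigma>" "(p, q) \<in> inversions n \<gamma>"
    and \<sigma>: "\<sigma> permutes {1..n}" "\<sigma> p = Suc (\<sigma> q)"
  shows "\<exists>r\<in>{1..<n}. \<beta> (Suc r) < \<beta> r \<and> \<gamma> (Suc r) < \<gamma> r"
proof -
  have pq: "1 \<le> p" "p < q" "q \<le> n" using \<beta>(3) by (auto simp: inversions_iff)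
  define r where "r = Max {r \<in> {p..<q}. \<sigma> q < \<sigma> r}"
  have ne: "p \<in> {r \<in> {p..<q}. \<sigma> q < \<sigma> r}" using pq \<sigma>(2) by simp
  have "r \<in> {r \<in> {p..<q}. \<sigma> q < \<sigma> r}"
    unfolding r_def by (rule Max_in) (use ne in \<open>simp, blast\<close>)
  then have r: "p \<le> r" "r < q" "\<sigma> q < \<sigma> r" by auto
  have Suc_r: "\<sigma> (Suc r) < \<sigma> q" if "Suc r \<noteq> q"
  proof -
    have "Suc r \<notin> {r \<in> {p..<q}. \<sigma> q < \<sigma> r}"
    proof
      assume "Suc r \<in> {r \<in> {p..<q}. \<sigma> q < \<sigma> r}"
      then have "Suc r \<le> r" using Max_ge[of "{r \<in> {p..<q}. \<sigma> q < \<sigma> r}" "Suc r"] unfolding r_def by simp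
      then show False by simp
    qed
    then show ?thesis using r that permutes_eq_iff[OF \<sigma>(1), of "Suc r" q] by force
  qed
  have "\<tau> (Suc r) < \<tau> r"
    if \<tau>: "\<tau> permutes {1..n}" "inversions n \<tau> \<subseteq> inversions n \<sigma>" "(p, q) \<in> inversions n \<tau>" for \<tau>
  proof -
    have "\<tau> q < \<tau> p" using \<tau>(3) by (simp add: inversions_iff)
    also have "\<tau> p \<le> \<tau> r"
    proof (cases "p = r")
      case False
      then have "\<sigma> p < \<sigma> r" using \<sigma>(2) r(3) permutes_eq_iff[OF \<sigma>(1), of p r] by simp
      then have "(p, r) \<notin> inversions n \<sigma>" by (simp add: inversions_iff)
      then have "(p, r) \<notin> inversions n \<tau>" using \<tau>(2) by blast
      then show ?thesis using not_inversion_less[OF \<tau>(1), of p r] False pq r by simp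
    qed simp
    finally have *: "\<tau> q < \<tau> r" .
    show ?thesis
    proof (cases "Suc r = q")
      case False
      then have "(Suc r, q) \<notin> inversions n \<sigma>" using Suc_r by (simp add: inversions_iff)
      then have "(Suc r, q) \<notin> inversions n \<tau>" using \<tau>(2) by blast
      then show ?thesis using not_inversion_less[OF \<tau>(1), of "Suc r" q] False pq r * by simp
    qed (use * in simp)
  qed
  then show ?thesis using \<beta> \<gamma> r pq by (intro bexI[of _ r]) auto
qed

text \<open>
  \<open>R\<^sub>b\<close> is the bottom part of \<open>R\<^sub>a \<bowtie> R\<^sub>b\<close>.
\<close>

lemma inversions_pinv_bowtie:
  assumes a: "a permutes {1..n}" and b: "b permutes {1..n}"
  shows "inversions n (pinv b) \<subseteq> inversions n (pinv (perm_bowtie n a b))"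
proof clarify
  fix i j assume ij: "(i, j) \<in> inversions n (pinv b)"
  let ?c = "transfer n a b"
  note c = transfer_permutes[OF a b]
  let ?p = "pinv b j" and ?q = "pinv b i"
  have "?p \<in> {1..n}" "?q \<in> {1..n}"
    by (rule permutes_bounds[OF permutes_inv[OF b]], use ij in \<open>simp add: inversions_iff\<close>)+
  moreover have "(?p, ?q) \<in> inversions n b" if "?p \<in> {1..n}" "?q \<in> {1..n}"
    using ij that by (auto simp: inversions_iff permutes_inverses[OF b])
  ultimately have "?c ?p < ?c ?q"
    using transfer_inversions_right[OF a b] ij
    by (intro not_inversion_less[OF c]) (auto simp: inversions_iff[of _ _ n "pinv b"])
  moreover have "pinv (perm_bowtie n a b) = pinv b \<cdot> ?c"
    unfolding perm_bowtie_def
    using pinv_pmult[OF permutes_inv[OF c] b] permutes_inv_inv[OF c] by simp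
  ultimately show "(i, j) \<in> inversions n (pinv (perm_bowtie n a b))"
    using ij by (auto simp: inversions_iff)
qed

text \<open>
  With \<open>S = a \<bowtie> b\<close> and \<open>c\<close> the part moved from \<open>S\<close> to \<open>b'\<close>: a violation at the positions \<open>k, k + 1\<close>
  means that these two strands cross in \<open>S\<close> but no longer in the top part \<open>S c\<close>, so they cross in the bottom
  part \<open>c\<inverse>\<close>. They also cross in the bottom part \<open>b\<close> of \<open>S\<close>, since they do not cross in the part
  moved from \<open>a\<close>. The inverses of these two bottom parts of \<open>S\<close> are top parts of \<open>S\<inverse>\<close>, as required
  for a common descent. It contradicts the normality of \<open>b, b'\<close>.
\<close>

lemma domino_rule:
  assumes a: "a permutes {1..n}" and b: "b permutes {1..n}" and b': "b' permutes {1..n}"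
    and normal: "normal_pair n b b'"
  shows "normal_pair n (perm_asymp n a b) (perm_asymp n (perm_bowtie n a b) b')"
  unfolding normal_pair_def
proof (intro ballI impI, rule ccontr)
  let ?S = "perm_bowtie n a b"
  let ?c = "transfer n ?S b'"
  note S = perm_bowtie_permutes[OF a b]
  note c = transfer_permutes[OF S b']
  fix k assume k: "k \<in> {1..<n}" and desc: "pinv (perm_asymp n a b) (Suc k) < pinv (perm_asymp n a b) k"
    and asc: "\<not> perm_asymp n ?S b' (Suc k) < perm_asymp n ?S b' k"
  define p q where "p = ?S (Suc k)" and "q = ?S k"
  have "p < q"
    using normal_pair_asymp_bowtie[OF a b] k desc by (simp add: normal_pair_def p_def q_def)
  have bounds: "p \<in> {1..n}" "q \<in> {1..n}"
    unfolding p_def q_def by (rule permutes_bounds[OF S], use k in simp)+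
  have "?c q < ?c p"
    using asc \<open>p < q\<close> permutes_eq_iff[OF c, of p q] by (simp add: perm_asymp_def p_def q_def)
  then have inv_c: "(p, q) \<in> inversions n ?c" using \<open>p < q\<close> bounds by (auto simp: inversions_iff)
  have "pinv b q < pinv b p"
    using asymp_descent_transfer[OF a b k desc]
    by (simp add: p_def q_def perm_bowtie_def permutes_inverses[OF b])
  then have inv_b: "(p, q) \<in> inversions n (pinv b)" using \<open>p < q\<close> bounds by (auto simp: inversions_iff)
  have "pinv ?S p = Suc (pinv ?S q)" by (simp add: p_def q_def permutes_inverses[OF S])
  then obtain r where r: "r \<in> {1..<n}" "pinv b (Suc r) < pinv b r" "?c (Suc r) < ?c r"
    using common_descent[OF permutes_inv[OF b] inversions_pinv_bowtie[OF a b] inv_b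
        c transfer_inversions_left[OF S b'] inv_c permutes_inv[OF S]] by blast
  then have "b' (Suc r) < b' r" using normal by (simp add: normal_pair_def)
  then have "(r, Suc r) \<in> inversions n ?c \<inter> inversions n b'" using r by (auto simp: inversions_iff)
  then show False using transfer_inversions_right[OF S b'] by simp
qed

section \<open>Permutations and crossings of words\<close>

lemma word_perm_append: "word_perm (u @ v) = word_perm u \<cdot> word_perm v"
  by (induction u) (auto simp: pmult_def comp_assoc)

lemma transpose_inject: "transpose a b c = transpose a b d \<longleftrightarrow> c = d"
  by (auto dest: transpose_eq_imp_eq)

lemma word_perm_permutes: "w \<in> lists {1..<n} \<Longrightarrow> word_perm w permutes {1..n}"
proof (induction w)
  case (Cons k w)
  then have "k \<in> {1..<n}" "word_perm w permutes {1..n}" by simp_all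
  then show ?case
    using pmult_permutes[OF adjacent_transposition_permutes] by (metis Suc_eq_plus1 word_perm.simps(2))
qed (simp add: permutes_id)

lemma inj_word_perm: "inj (word_perm w)"
proof (induction w)
  case (Cons k w)
  then show ?case unfolding word_perm.simps pmult_def by (intro inj_compose inj_transpose)
qed simp

lemma crossings_append:
  "crossings (u @ v) i j = crossings u i j + crossings v (word_perm u i) (word_perm u j)"
  by (induction u arbitrary: i j) auto

lemma crossings_commute: "crossings w i j = crossings w j i"
  by (induction w arbitrary: i j) (auto simp: insert_commute)

text \<open>
  Each crossing of two strands exchanges their order.
\<close>

lemma odd_crossings_iff:
  "i \<noteq> j \<Longrightarrow> odd (crossings w i j) \<longleftrightarrow> (i < j) \<noteq> (word_perm w i < word_perm w j)"
proof (induction w arbitrary: i j)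
  case (Cons k w)
  let ?s = "transpose k (Suc k)"
  have "?s i \<noteq> ?s j" using Cons.prems by (simp add: transpose_inject)
  with Cons.IH[OF this] show ?case
    using transpose_less_iff[OF Cons.prems, of k] Cons.prems by auto
qed simp

text \<open>
  All natural numbers are admitted as positions, which avoids a parameter \<open>n\<close>: in a word over
  \<open>{1..<n}\<close> the strands outside \<open>{1..n}\<close> cross nothing.
\<close>

definition reduced :: "nat list \<Rightarrow> bool"
  where "reduced w \<longleftrightarrow> (\<forall>i j. i \<noteq> j \<longrightarrow> crossings w i j \<le> 1)"

lemma reduced_crossings:
  assumes "reduced w" "i \<noteq> j"
  shows "crossings w i j = (if (i < j) = (word_perm w i < word_perm w j) then 0 else 1)"
proof -
  have "crossings w i j \<le> 1" using assms by (simp add: reduced_def)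
  then have "crossings w i j = 0 \<or> crossings w i j = 1" by linarith
  then show ?thesis using odd_crossings_iff[OF assms(2), of w] by auto
qed

lemma reduced_Cons_iff: "reduced (k # w) \<longleftrightarrow> reduced w \<and> word_perm w k < word_perm w (Suc k)"
proof
  assume r: "reduced (k # w)"
  have w: "crossings w i j \<le> 1" if "i \<noteq> j" for i j
  proof -
    have "transpose k (Suc k) i \<noteq> transpose k (Suc k) j" using that by (simp add: transpose_inject)
    then have "crossings (k # w) (transpose k (Suc k) i) (transpose k (Suc k) j) \<le> 1"
      using r unfolding reduced_def by blast
    then show ?thesis by (simp split: if_splits)
  qed
  have "crossings (k # w) k (Suc k) \<le> 1" using r unfolding reduced_def by (metis n_not_Suc_n)
  then have "crossings w k (Suc k) = 0" by (simp add: crossings_commute[of w "Suc k"])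
  then show "reduced w \<and> word_perm w k < word_perm w (Suc k)"
    using w odd_crossings_iff[of k "Suc k" w] by (simp add: reduced_def)
next
  assume w: "reduced w \<and> word_perm w k < word_perm w (Suc k)"
  have "crossings (k # w) i j \<le> 1" if "i \<noteq> j" for i j
  proof (cases "{i, j} = {k, Suc k}")
    case True
    then have "crossings w (transpose k (Suc k) i) (transpose k (Suc k) j) = crossings w k (Suc k)"
      using crossings_commute by (auto simp: doubleton_eq_iff)
    also have "\<dots> = 0" using w reduced_crossings[of w k "Suc k"] by simp
    finally show ?thesis by simp
  next
    case False
    have "transpose k (Suc k) i \<noteq> transpose k (Suc k) j" using that by (simp add: transpose_inject)
    then show ?thesis using False w by (simp add: reduced_def)
  qed
  then show "reduced (k # w)" by (simp add: reduced_def)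
qed

text \<open>
  Strands that cross in \<open>u\<close> arrive in reversed order and must not cross again in \<open>v\<close>.
\<close>

lemma reduced_append:
  assumes "reduced u" "reduced v"
    and "\<And>i j. i < j \<Longrightarrow> word_perm u j < word_perm u i \<Longrightarrow> word_perm v (word_perm u j) < word_perm v (word_perm u i)"
  shows "reduced (u @ v)"
  unfolding reduced_def
proof (intro allI impI)
  fix i j :: nat assume "i \<noteq> j"
  have *: "word_perm u i \<noteq> word_perm u j" using \<open>i \<noteq> j\<close> inj_word_perm[of u] by (simp add: inj_eq)
  show "crossings (u @ v) i j \<le> 1"
    unfolding crossings_append reduced_crossings[OF assms(1) \<open>i \<noteq> j\<close>] reduced_crossings[OF assms(2) *]
    using assms(3)[of i j] assms(3)[of j i] \<open>i \<noteq> j\<close> * by (auto simp: neq_iff)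
qed

text \<open>
  Bubble sort: splitting off an adjacent inversion lowers the number of inversions by one.
\<close>

lemma exists_reduced_word:
  assumes "\<pi> permutes {1..n}"
  shows "\<exists>w\<in>lists {1..<n}. reduced w \<and> word_perm w = \<pi>"
  using assms
proof (induction "card (inversions n \<pi>)" arbitrary: \<pi> rule: less_induct)
  case less
  have fin: "finite (inversions n \<rho>)" for \<rho>
    by (rule finite_subset[of _ "{1..n} \<times> {1..n}"]) (auto simp: inversions_def)
  show ?case
  proof (cases "\<exists>k\<in>{1..<n}. \<pi> (Suc k) < \<pi> k")
    case False
    then have "\<pi> = id" using no_descent_imp_id[OF less.prems] by blast
    then show ?thesis by (intro bexI[of _ "[]"]) (auto simp: reduced_def)
  next
    case True
    then obtain k where k: "k \<in> {1..<n}" "\<pi> (Suc k) < \<pi> k" by blast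
    let ?s = "transpose k (Suc k)"
    have s: "?s permutes {1..n}" by (rule adjacent_transposition_permutes[OF k(1)])
    let ?\<rho> = "?s \<cdot> \<pi>"
    have "map_prod ?s ?s ` inversions n ?\<rho> \<subseteq> inversions n \<pi> - {(k, Suc k)}"
    proof (rule image_subsetI)
      fix x assume "x \<in> inversions n ?\<rho>"
      then obtain i j where x: "x = (i, j)" and "(i, j) \<in> inversions n ?\<rho>" by (cases x) auto
      then have ij: "1 \<le> i" "i < j" "j \<le> n" "\<pi> (?s j) < \<pi> (?s i)" by (simp_all add: inversions_iff)
      have "{i, j} \<noteq> {k, Suc k}" using ij k(2) by (auto simp: doubleton_eq_iff)
      then have less: "?s i < ?s j" and "(?s i, ?s j) \<noteq> (k, Suc k)"
        using ij transpose_less_iff[of i j k] by (auto simp: transpose_eq_iff)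
      moreover have "?s i \<in> {1..n}" "?s j \<in> {1..n}"
        by (rule permutes_bounds[OF s], use ij in simp)+
      ultimately show "map_prod ?s ?s x \<in> inversions n \<pi> - {(k, Suc k)}"
        using ij by (simp add: inversions_iff x)
    qed
    moreover have "inj_on (map_prod ?s ?s) (inversions n ?\<rho>)"
      by (intro inj_onI) (auto simp: transpose_inject)
    ultimately have "card (inversions n ?\<rho>) \<le> card (inversions n \<pi> - {(k, Suc k)})"
      using fin by (intro card_inj_on_le) auto
    also have "\<dots> < card (inversions n \<pi>)"
      using k fin by (intro card_Diff1_less) (auto simp: inversions_iff)
    finally have "\<exists>w\<in>lists {1..<n}. reduced w \<and> word_perm w = ?\<rho>"
      by (rule less.hyps[OF _ pmult_permutes[OF s less.prems]])
    then obtain w where w: "w \<in> lists {1..<n}" "reduced w" "word_perm w = ?\<rho>" by blast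
    have "word_perm (k # w) = \<pi>" by (simp add: w fun_eq_iff)
    moreover have "reduced (k # w)" using w k by (simp add: reduced_Cons_iff)
    ultimately show ?thesis using w(1) k(1) by (intro bexI[of _ "k # w"]) simp_all
  qed
qed

section \<open>Braid equivalence\<close>

abbreviation braid_equiv :: "nat list \<Rightarrow> nat list \<Rightarrow> bool"
  where "braid_equiv \<equiv> equivclp braid_step"

lemma equivclp_map:
  assumes "\<And>x y. R x y \<Longrightarrow> S (f x) (f y)" "equivclp R x y"
  shows "equivclp S (f x) (f y)"
  using assms(2)
proof (induction rule: equivclp_induct)
  case (step y z)
  then have "equivclp S (f y) (f z)" using assms(1) equivclp_sym by (metis r_into_equivclp)
  with step.IH show ?case by (rule equivclp_trans)
qed simp

lemma equivclp_invariant: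
  assumes "\<And>x y. R x y \<Longrightarrow> f x = f y" "equivclp R x y"
  shows "f x = f y"
  using assms(2)
proof (induction rule: equivclp_induct)
  case (step y z)
  then show ?case using assms(1)[of y z] assms(1)[of z y] by auto
qed simp

lemma braid_step_context: "braid_step u v \<Longrightarrow> braid_step (x @ u @ y) (x @ v @ y)"
proof (induction rule: braid_step.induct)
  case (far i j u v)
  then show ?case using braid_step.far[of i j "x @ u" "v @ y"] by simp
next
  case (near u i v)
  then show ?case using braid_step.near[of "x @ u" i "v @ y"] by simp
qed

lemma braid_equiv_append:
  assumes "braid_equiv u u'" "braid_equiv v v'"
  shows "braid_equiv (u @ v) (u' @ v')"
proof -
  have "braid_equiv (u @ v) (u' @ v)"
    by (rule equivclp_map[where f = "\<lambda>u. u @ v", OF _ assms(1)]) (use braid_step_context[of _ _ "[]"] in simp)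
  moreover have "braid_equiv (u' @ v) (u' @ v')"
    by (rule equivclp_map[where f = "\<lambda>v. u' @ v", OF _ assms(2)]) (use braid_step_context[of _ _ _ "[]"] in simp)
  ultimately show ?thesis by (rule equivclp_trans)
qed

lemma braid_equiv_Cons: "braid_equiv u v \<Longrightarrow> braid_equiv (k # u) (k # v)"
  using braid_equiv_append[of "[k]" "[k]" u v] by simp

lemma braid_equiv_commute:
  assumes "i + 2 \<le> j \<or> j + 2 \<le> i"
  shows "braid_equiv (i # j # w) (j # i # w)"
proof -
  have *: "braid_equiv (i # j # w) (j # i # w)" if "i + 2 \<le> j" for i j
    using braid_step.far[OF that, where u = "[]" and v = w] by (simp add: r_into_equivclp)
  show ?thesis using assms *[of i j] equivclp_sym[OF *[of j i]] by blast
qed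

lemma braid_equiv_braid:
  assumes "j = Suc i \<or> i = Suc j"
  shows "braid_equiv (i # j # i # w) (j # i # j # w)"
proof -
  have *: "braid_equiv (i # Suc i # i # w) (Suc i # i # Suc i # w)" for i
    using braid_step.near[where u = "[]" and i = i and v = w] by (simp add: r_into_equivclp)
  show ?thesis using assms *[of i] equivclp_sym[OF *[of j]] by blast
qed

lemma length_braid_equiv: "braid_equiv u v \<Longrightarrow> length u = length v"
  by (rule equivclp_invariant[where R = braid_step]) (auto elim: braid_step.cases)

lemma word_perm_braid_step: "braid_step u v \<Longrightarrow> word_perm u = word_perm v"
proof (induction rule: braid_step.induct)
  case (far i j u v)
  have "word_perm [i, j] = word_perm [j, i]" using far by (auto simp: fun_eq_iff transpose_def)
  then show ?case by (simp only: word_perm_append)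
next
  case (near u i v)
  have "word_perm [i, i + 1, i] = word_perm [i + 1, i, i + 1]" by (auto simp: fun_eq_iff transpose_def)
  then show ?case by (simp only: word_perm_append)
qed

lemma crossings_braid_step: "braid_step u v \<Longrightarrow> crossings u = crossings v"
proof (induction rule: braid_step.induct)
  case (far i j u v)
  have "word_perm [i, j] = word_perm [j, i]" using far by (auto simp: fun_eq_iff transpose_def)
  moreover have "crossings [i, j] a b = crossings [j, i] a b" for a b
    using far by (auto simp: transpose_def doubleton_eq_iff)
  ultimately show ?case by (simp only: fun_eq_iff word_perm_append crossings_append) simp
next
  case (near u i v)
  have "word_perm [i, i + 1, i] = word_perm [i + 1, i, i + 1]" by (auto simp: fun_eq_iff transpose_def)
  moreover have "crossings [i, i + 1, i] a b = crossings [i + 1, i, i + 1] a b" for a b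
    by (auto simp: transpose_def doubleton_eq_iff)
  ultimately show ?case by (simp only: fun_eq_iff word_perm_append crossings_append) simp
qed

lemma word_perm_braid_equiv: "braid_equiv u v \<Longrightarrow> word_perm u = word_perm v"
  by (rule equivclp_invariant[where R = braid_step, OF word_perm_braid_step])

lemma crossings_braid_equiv: "braid_equiv u v \<Longrightarrow> crossings u = crossings v"
  by (rule equivclp_invariant[where R = braid_step, OF crossings_braid_step])

text \<open>
  Matsumoto's theorem for the symmetric group. Let the words begin with \<open>i\<close> and \<open>j\<close>. If \<open>i \<noteq> j\<close>, both
  are descents of the permutation, so it also has reduced words that begin with \<open>i j\<close> and with
  \<open>j i\<close> (for distant letters) or with \<open>i j i\<close> and with \<open>j i j\<close> (for neighbouring ones) and agree
  afterwards. One braid relation connects these two, and the induction hypothesis, applied below the first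
  letters, connects them to the given words.
\<close>

lemma reduced_words_braid_equiv:
  assumes "u \<in> lists {1..<n}" "v \<in> lists {1..<n}" "reduced u" "reduced v" "word_perm u = word_perm v"
  shows "braid_equiv u v"
  using assms
proof (induction "length u" arbitrary: u v rule: less_induct)
  case less
  have desc: "word_perm (k # w) (Suc k) < word_perm (k # w) k" if "reduced (k # w)" for k w
    using that by (simp add: reduced_Cons_iff)
  show ?case
  proof (cases u)
    case Nil
    have "v = []"
    proof (cases v)
      case (Cons k w)
      then have "id (Suc k) < id k" using desc[of k w] less.prems(4,5) Nil by (simp del: word_perm.simps(2))
      then show ?thesis by simp
    qed
    then show ?thesis using Nil by simp
  next
    case u: (Cons i u')
    obtain j v' where v: "v = j # v'"
    proof (cases v)
      case Nil
      then have "id (Suc i) < id i" using desc[of i u'] less.prems(3,5) u by (simp del: word_perm.simps(2))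
      then show ?thesis by simp
    qed
    define \<pi> where "\<pi> = word_perm u"
    let ?s = "\<lambda>k. transpose k (Suc k)"
    have \<pi>: "\<pi> permutes {1..n}" unfolding \<pi>_def by (rule word_perm_permutes[OF less.prems(1)])
    have ij: "i \<in> {1..<n}" "j \<in> {1..<n}" using less.prems u v by auto
    have di: "\<pi> (Suc i) < \<pi> i" using desc[of i u'] less.prems(3) by (simp add: \<pi>_def u)
    have dj: "\<pi> (Suc j) < \<pi> j" using desc[of j v'] less.prems(4) unfolding \<pi>_def less.prems(5) by (simp add: v)
    have u': "u' \<in> lists {1..<n}" "reduced u'" "word_perm u' = ?s i \<cdot> \<pi>"
      using less.prems(1,3) unfolding \<pi>_def by (auto simp: u reduced_Cons_iff fun_eq_iff)
    have v': "v' \<in> lists {1..<n}" "reduced v'" "word_perm v' = ?s j \<cdot> \<pi>"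
      using less.prems(2,4) unfolding \<pi>_def less.prems(5) by (auto simp: v reduced_Cons_iff fun_eq_iff)
    have s: "?s i permutes {1..n}" "?s j permutes {1..n}"
      using ij by (intro adjacent_transposition_permutes; simp)+
    have IH: "braid_equiv u1 u2"
      if "length u1 = length u'" "u1 \<in> lists {1..<n}" "u2 \<in> lists {1..<n}"
        "reduced u1" "reduced u2" "word_perm u1 = word_perm u2" for u1 u2
      using less.hyps[of u1 u2] that u by simp
    \<comment> \<open>The lengths agree with that of \<open>u'\<close> in every use below because braid relations preserve length.\<close>
    consider "i = j" | "i + 2 \<le> j \<or> j + 2 \<le> i" | "j = Suc i \<or> i = Suc j" by linarith
    then show ?thesis
    proof cases
      case 1
      then have "braid_equiv u' v'" using IH[of u' v'] u' v' by simp
      then show ?thesis using 1 unfolding u v by (simp add: braid_equiv_Cons)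
    next
      case 2
      obtain z where z: "z \<in> lists {1..<n}" "reduced z" "word_perm z = ?s i \<cdot> (?s j \<cdot> \<pi>)"
        using exists_reduced_word[OF pmult_permutes[OF s(1) pmult_permutes[OF s(2) \<pi>]]] by blast
      have "word_perm (j # z) = word_perm u'"
        using 2 by (auto simp: u' z fun_eq_iff transpose_def)
      moreover have "reduced (j # z)"
        using 2 z dj by (auto simp: reduced_Cons_iff transpose_def)
      ultimately have "braid_equiv u' (j # z)"
        using IH[of u' "j # z"] u' z ij by simp
      moreover have "word_perm (i # z) = word_perm v'"
        using 2 by (auto simp: v' z fun_eq_iff transpose_def)
      moreover have "reduced (i # z)"
        using 2 z di by (auto simp: reduced_Cons_iff transpose_def)
      ultimately have "braid_equiv (i # z) v'"
        using IH[of "i # z" v'] v' z ij length_braid_equiv[of u' "j # z"] by simp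
      then show ?thesis
        using braid_equiv_Cons[OF \<open>braid_equiv u' (j # z)\<close>, of i] braid_equiv_Cons[of "i # z" v' j]
          braid_equiv_commute[OF 2, of z] \<open>braid_equiv (i # z) v'\<close>
        unfolding u v by (blast intro: equivclp_trans)
    next
      case 3
      obtain z where z: "z \<in> lists {1..<n}" "reduced z" "word_perm z = ?s i \<cdot> (?s j \<cdot> (?s i \<cdot> \<pi>))"
        using exists_reduced_word[OF pmult_permutes[OF s(1) pmult_permutes[OF s(2) pmult_permutes[OF s(1) \<pi>]]]] by blast
      have braid: "?s i (?s j (?s i x)) = ?s j (?s i (?s j x))" for x
        using 3 by (auto simp: transpose_def)
      have "word_perm (j # i # z) = word_perm u'" by (simp add: u' z fun_eq_iff)
      moreover have "reduced (j # i # z)"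
        using 3 z di dj by (auto simp: reduced_Cons_iff transpose_def)
      ultimately have "braid_equiv u' (j # i # z)"
        using IH[of u' "j # i # z"] u' z ij by simp
      moreover have "word_perm (i # j # z) = word_perm v'"
        by (simp add: v' z fun_eq_iff braid)
      moreover have "reduced (i # j # z)"
        using 3 z di dj by (auto simp: reduced_Cons_iff transpose_def)
      ultimately have "braid_equiv (i # j # z) v'"
        using IH[of "i # j # z" v'] v' z ij length_braid_equiv[of u' "j # i # z"] by simp
      then show ?thesis
        using braid_equiv_Cons[OF \<open>braid_equiv u' (j # i # z)\<close>, of i] braid_equiv_Cons[of "i # j # z" v' j]
          braid_equiv_braid[OF 3, of z] \<open>braid_equiv (i # j # z) v'\<close>
        unfolding u v by (blast intro: equivclp_trans)
    qed
  qed
qed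

section \<open>Non-repeating braids and their products\<close>

definition braid_of :: "nat \<Rightarrow> nat list \<Rightarrow> braid"
  where "braid_of n w = braid_cong n `` {w}"

lemma equiv_braid_cong: "equiv (lists {1..<n}) (braid_cong n)"
proof (rule equivI)
  show "braid_cong n \<subseteq> lists {1..<n} \<times> lists {1..<n}" by (auto simp: braid_cong_def)
  show "refl_on (lists {1..<n}) (braid_cong n)" by (auto simp: refl_on_def braid_cong_def)
  show "sym (braid_cong n)" by (auto simp: sym_def braid_cong_def intro: equivclp_sym)
  show "trans (braid_cong n)" by (auto simp: trans_def braid_cong_def intro: equivclp_trans)
qed

lemma mem_braid_of:
  "w \<in> lists {1..<n} \<Longrightarrow> v \<in> braid_of n w \<longleftrightarrow> v \<in> lists {1..<n} \<and> braid_equiv w v"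
  by (auto simp: braid_of_def braid_cong_def)

lemma self_mem_braid_of: "w \<in> lists {1..<n} \<Longrightarrow> w \<in> braid_of n w"
  by (simp add: mem_braid_of)

lemma braid_of_eq_iff:
  assumes "u \<in> lists {1..<n}" "v \<in> lists {1..<n}"
  shows "braid_of n u = braid_of n v \<longleftrightarrow> braid_equiv u v"
  unfolding braid_of_def eq_equiv_class_iff[OF equiv_braid_cong assms]
  using assms by (simp add: braid_cong_def)

lemma carrier_Br_iff: "X \<in> carrier (Br n) \<longleftrightarrow> (\<exists>w\<in>lists {1..<n}. X = braid_of n w)"
  by (auto simp: Br_def quotient_def braid_of_def)

lemma one_Br: "\<one>\<^bsub>Br n\<^esub> = braid_of n []"
  by (simp add: Br_def braid_of_def)

lemma mult_braid_of:
  assumes u: "u \<in> lists {1..<n}" and v: "v \<in> lists {1..<n}"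
  shows "braid_of n u \<otimes>\<^bsub>Br n\<^esub> braid_of n v = braid_of n (u @ v)"
proof -
  have uv: "u @ v \<in> lists {1..<n}" using u v by simp
  have "braid_cong n `` {x @ y |x y. x \<in> braid_of n u \<and> y \<in> braid_of n v} = braid_of n (u @ v)"
  proof (intro equalityI subsetI)
    fix z assume "z \<in> braid_cong n `` {x @ y |x y. x \<in> braid_of n u \<and> y \<in> braid_of n v}"
    then obtain x y where "x \<in> braid_of n u" "y \<in> braid_of n v" "(x @ y, z) \<in> braid_cong n" by blast
    then have "braid_equiv u x" "braid_equiv v y" and z: "z \<in> lists {1..<n}" "braid_equiv (x @ y) z"
      unfolding mem_braid_of[OF u] mem_braid_of[OF v] by (simp_all add: braid_cong_def)
    then have "braid_equiv (u @ v) z" by (blast intro: equivclp_trans braid_equiv_append)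
    then show "z \<in> braid_of n (u @ v)" unfolding mem_braid_of[OF uv] using z by blast
  next
    fix z assume "z \<in> braid_of n (u @ v)"
    then have "(u @ v, z) \<in> braid_cong n" by (simp add: braid_of_def)
    then show "z \<in> braid_cong n `` {x @ y |x y. x \<in> braid_of n u \<and> y \<in> braid_of n v}"
      using self_mem_braid_of[OF u] self_mem_braid_of[OF v] by blast
  qed
  then show ?thesis by (simp add: Br_def)
qed

lemma Br_assoc:
  assumes "X \<in> carrier (Br n)" "Y \<in> carrier (Br n)" "Z \<in> carrier (Br n)"
  shows "X \<otimes>\<^bsub>Br n\<^esub> Y \<otimes>\<^bsub>Br n\<^esub> Z = X \<otimes>\<^bsub>Br n\<^esub> (Y \<otimes>\<^bsub>Br n\<^esub> Z)"
proof -
  obtain u v w where "u \<in> lists {1..<n}" "v \<in> lists {1..<n}" "w \<in> lists {1..<n}"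
    "X = braid_of n u" "Y = braid_of n v" "Z = braid_of n w"
    using assms carrier_Br_iff by metis
  then show ?thesis by (simp add: mult_braid_of)
qed

lemma word_braid_closed:
  assumes "set Xs \<subseteq> carrier (Br n)"
  shows "word_braid n Xs \<in> carrier (Br n)"
  using assms
proof (induction Xs)
  case Nil
  then show ?case by (auto simp: word_braid_def one_Br carrier_Br_iff)
next
  case (Cons X Xs)
  then have "X \<in> carrier (Br n)" "word_braid n Xs \<in> carrier (Br n)" by auto
  then obtain u v where "u \<in> lists {1..<n}" "v \<in> lists {1..<n}" "X = braid_of n u" "word_braid n Xs = braid_of n v"
    unfolding carrier_Br_iff by blast
  then have "word_braid n (X # Xs) = braid_of n (u @ v)" "u @ v \<in> lists {1..<n}"
    by (simp_all add: word_braid_def mult_braid_of)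
  then show ?case unfolding carrier_Br_iff by blast
qed

lemma braid_perm_braid_of:
  assumes "w \<in> lists {1..<n}"
  shows "braid_perm (braid_of n w) = word_perm w"
proof -
  have "word_perm ` braid_of n w = {word_perm w}"
  proof (intro equalityI subsetI)
    fix p assume "p \<in> word_perm ` braid_of n w"
    then obtain v where "v \<in> braid_of n w" "p = word_perm v" by blast
    then show "p \<in> {word_perm w}"
      using word_perm_braid_equiv[of w v] unfolding mem_braid_of[OF assms] by simp
  qed (use self_mem_braid_of[OF assms] in blast)
  then show ?thesis by (simp add: braid_perm_def)
qed

lemma crossings_outside: "w \<in> lists {1..<n} \<Longrightarrow> i \<notin> {1..n} \<Longrightarrow> crossings w i j = 0"
proof (induction w arbitrary: j)
  case (Cons k w)
  then have "transpose k (Suc k) i = i" "{i, j} \<noteq> {k, Suc k}"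
    by (auto simp: transpose_def doubleton_eq_iff)
  then show ?case using Cons by simp
qed simp

lemma braid_of_nonrepeating_iff:
  assumes "w \<in> lists {1..<n}"
  shows "braid_of n w \<in> nonrepeating n \<longleftrightarrow> reduced w"
proof
  assume "braid_of n w \<in> nonrepeating n"
  then have "i \<in> {1..n} \<Longrightarrow> j \<in> {1..n} \<Longrightarrow> i \<noteq> j \<Longrightarrow> crossings w i j \<le> 1" for i j
    using self_mem_braid_of[OF assms] unfolding nonrepeating_def by blast
  then show "reduced w"
    unfolding reduced_def using crossings_outside[OF assms] crossings_commute by (metis zero_le)
next
  assume w: "reduced w"
  have "crossings v i j \<le> 1" if "v \<in> braid_of n w" "i \<noteq> j" for v i j
  proof -
    have "crossings w = crossings v"
      using that(1) crossings_braid_equiv unfolding mem_braid_of[OF assms] by blast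
    then show ?thesis using w that(2) unfolding reduced_def by metis
  qed
  then show "braid_of n w \<in> nonrepeating n"
    using assms unfolding nonrepeating_def carrier_Br_iff by blast
qed

text \<open>
  Uniqueness of the braid that \<open>nr_braid\<close> describes is Matsumoto's theorem.
\<close>

lemma nr_braid_eq:
  assumes w: "w \<in> lists {1..<n}" "reduced w"
  shows "nr_braid n (word_perm w) = braid_of n w"
  unfolding nr_braid_def
proof (rule the_equality)
  show "braid_of n w \<in> nonrepeating n \<and> braid_perm (braid_of n w) = word_perm w"
    using w by (simp add: braid_of_nonrepeating_iff braid_perm_braid_of)
next
  fix X assume X: "X \<in> nonrepeating n \<and> braid_perm X = word_perm w"
  then have "X \<in> carrier (Br n)" by (simp add: nonrepeating_def)
  then obtain v where v: "v \<in> lists {1..<n}" "X = braid_of n v" unfolding carrier_Br_iff by blast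
  then have "reduced v" "word_perm v = word_perm w"
    using X braid_of_nonrepeating_iff[OF v(1)] braid_perm_braid_of[OF v(1)] by auto
  then show "X = braid_of n w"
    using v w reduced_words_braid_equiv[OF v(1) w(1)] by (simp add: braid_of_eq_iff)
qed

lemma
  assumes "\<pi> permutes {1..n}"
  shows nr_braid_nonrepeating: "nr_braid n \<pi> \<in> nonrepeating n"
    and braid_perm_nr_braid: "braid_perm (nr_braid n \<pi>) = \<pi>"
proof -
  obtain w where "w \<in> lists {1..<n}" "reduced w" "word_perm w = \<pi>"
    using exists_reduced_word[OF assms] by blast
  then show "nr_braid n \<pi> \<in> nonrepeating n" "braid_perm (nr_braid n \<pi>) = \<pi>"
    using nr_braid_eq[of w n] by (auto simp: braid_of_nonrepeating_iff braid_perm_braid_of)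
qed

lemma nr_braid_carrier: "\<pi> permutes {1..n} \<Longrightarrow> nr_braid n \<pi> \<in> carrier (Br n)"
  using nr_braid_nonrepeating by (auto simp: nonrepeating_def)

text \<open>
  No two strands cross both in \<open>\<pi>\<close> and in \<open>\<rho>\<close>: named by their positions between the factors, the
  strands that cross in the first one are the inversions of \<open>\<pi>\<inverse>\<close>.
\<close>

lemma nr_braid_mult:
  assumes \<pi>: "\<pi> permutes {1..n}" and \<rho>: "\<rho> permutes {1..n}"
    and disjoint: "inversions n (pinv \<pi>) \<inter> inversions n \<rho> = {}"
  shows "nr_braid n \<pi> \<otimes>\<^bsub>Br n\<^esub> nr_braid n \<rho> = nr_braid n (\<pi> \<cdot> \<rho>)"
proof -
  obtain u where u: "u \<in> lists {1..<n}" "reduced u" "word_perm u = \<pi>"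
    using exists_reduced_word[OF \<pi>] by blast
  obtain v where v: "v \<in> lists {1..<n}" "reduced v" "word_perm v = \<rho>"
    using exists_reduced_word[OF \<rho>] by blast
  have "reduced (u @ v)"
  proof (rule reduced_append[OF u(2) v(2)], unfold u(3) v(3))
    fix i j assume ij: "i < j" "\<pi> j < \<pi> i"
    show "\<rho> (\<pi> j) < \<rho> (\<pi> i)"
    proof (cases "1 \<le> \<pi> j \<and> \<pi> i \<le> n")
      case True
      then have "(\<pi> j, \<pi> i) \<in> inversions n (pinv \<pi>)"
        using ij by (simp add: inversions_iff permutes_inverses[OF \<pi>])
      then show ?thesis using not_inversion_less[OF \<rho>, of "\<pi> j" "\<pi> i"] True ij disjoint by blast
    next
      \<comment> \<open>Outside \<open>{1..n}\<close> the permutation is the identity, so such a strand is in no inversion.\<close>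
      case False
      then have "\<pi> j \<notin> {1..n} \<or> \<pi> i \<notin> {1..n}" by auto
      then have "j \<notin> {1..n} \<or> i \<notin> {1..n}" using permutes_bounds[OF \<pi>] by blast
      then have False
        using ij permutes_not_in[OF \<pi>, of i] permutes_not_in[OF \<pi>, of j]
          permutes_bounds[OF \<pi>, of i] permutes_bounds[OF \<pi>, of j]
        unfolding atLeastAtMost_iff by linarith
      then show ?thesis ..
    qed
  qed
  moreover have "u @ v \<in> lists {1..<n}" using u(1) v(1) by simp
  ultimately have "nr_braid n (word_perm u \<cdot> word_perm v) = braid_of n (u @ v)"
    using nr_braid_eq by (metis word_perm_append)
  then show ?thesis
    unfolding u(3)[symmetric] v(3)[symmetric] nr_braid_eq[OF u(1,2)] nr_braid_eq[OF v(1,2)]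
    by (simp only: mult_braid_of[OF u(1) v(1)])
qed

lemma th_asymp_nr_braid:
  "a permutes {1..n} \<Longrightarrow> b permutes {1..n} \<Longrightarrow>
    th_asymp n (nr_braid n a) (nr_braid n b) = nr_braid n (perm_asymp n a b)"
  by (simp only: th_asymp_def perm_asymp_def transfer_def braid_perm_nr_braid Let_def)

lemma th_bowtie_nr_braid:
  "a permutes {1..n} \<Longrightarrow> b permutes {1..n} \<Longrightarrow>
    th_bowtie n (nr_braid n a) (nr_braid n b) = nr_braid n (perm_bowtie n a b)"
  by (simp only: th_bowtie_def perm_bowtie_def transfer_def braid_perm_nr_braid Let_def)

text \<open>
  With \<open>c\<close> the transferred part, both sides equal \<open>R\<^bsub>ac\<^esub> R\<^bsub>c\<inverse>\<^esub> R\<^sub>b\<close>.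
\<close>

lemma nr_braid_mult_asymp_bowtie:
  assumes a: "a permutes {1..n}" and b: "b permutes {1..n}"
  shows "nr_braid n (perm_asymp n a b) \<otimes>\<^bsub>Br n\<^esub> nr_braid n (perm_bowtie n a b) =
    nr_braid n a \<otimes>\<^bsub>Br n\<^esub> nr_braid n b"
proof -
  let ?c = "transfer n a b"
  note c = transfer_permutes[OF a b]
  note x = perm_asymp_permutes[OF a b] and c' = permutes_inv[OF c]
  have "inversions n (pinv (perm_asymp n a b)) \<inter> inversions n (pinv ?c) = {}"
  proof -
    have False if ij: "(i, j) \<in> inversions n (pinv (perm_asymp n a b))" "(i, j) \<in> inversions n (pinv ?c)" for i j
    proof -
      have "pinv ?c i \<in> {1..n}" "pinv ?c j \<in> {1..n}"
        by (rule permutes_bounds[OF c'], use ij in \<open>simp add: inversions_iff\<close>)+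
      then have "(pinv ?c j, pinv ?c i) \<in> inversions n ?c"
        using ij(2) by (auto simp: inversions_iff permutes_inverses[OF c])
      then have "(pinv ?c j, pinv ?c i) \<in> inversions n (pinv a)"
        using transfer_inversions_left[OF a b] by blast
      then show False using ij(1) by (simp add: perm_asymp_def pinv_pmult[OF a c] inversions_iff)
    qed
    then show ?thesis by auto
  qed
  then have 1: "nr_braid n (perm_asymp n a b) \<otimes>\<^bsub>Br n\<^esub> nr_braid n (pinv ?c) = nr_braid n a"
    using nr_braid_mult[OF x c'] by (simp add: perm_asymp_def pmult_assoc) (simp add: pmult_def permutes_inv_o[OF c])
  have 2: "nr_braid n (pinv ?c) \<otimes>\<^bsub>Br n\<^esub> nr_braid n b = nr_braid n (perm_bowtie n a b)"
    using nr_braid_mult[OF c' b] transfer_inversions_right[OF a b]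
    by (simp add: perm_bowtie_def permutes_inv_inv[OF c])
  show ?thesis
    unfolding 1[symmetric] 2[symmetric]
    by (rule Br_assoc[symmetric]) (intro nr_braid_carrier x c' b)+
qed

lemma greedy_normal_form_iff:
  assumes "\<forall>p\<in>set ps. p permutes {1..n}"
  shows "greedy_normal_form n (map (nr_braid n) ps) \<longleftrightarrow> successively (normal_pair n) ps"
proof -
  have "braid_meet n (star n (nr_braid n x)) (neg n (nr_braid n y)) = nr_braid n id \<longleftrightarrow> normal_pair n x y"
    if x: "x permutes {1..n}" and y: "y permutes {1..n}" for x y
  proof -
    note p = permutes_inv[OF x] pmult_permutes[OF y flip_permutes]
    have "nr_braid n \<mu> = nr_braid n id \<longleftrightarrow> \<mu> = id" if "\<mu> permutes {1..n}" for \<mu>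
      using braid_perm_nr_braid[OF that] braid_perm_nr_braid[OF permutes_id] by metis
    from this[OF pmeet_permutes[OF p]] show ?thesis
      by (simp add: braid_meet_def star_def neg_def braid_perm_nr_braid[OF x] braid_perm_nr_braid[OF y]
          braid_perm_nr_braid[OF p(1)] braid_perm_nr_braid[OF p(2)] normal_pair_iff_pmeet[OF x y])
  qed
  moreover have "set (map (nr_braid n) ps) \<subseteq> nonrepeating n"
    using assms nr_braid_nonrepeating by auto
  ultimately show ?thesis
    using assms unfolding greedy_normal_form_def successively_conv_nth by auto
qed

section \<open>Thurston's automaton\<close>

fun thurston_output :: "nat \<Rightarrow> (nat \<Rightarrow> nat) \<Rightarrow> (nat \<Rightarrow> nat) list \<Rightarrow> (nat \<Rightarrow> nat) list"
  where
    "thurston_output n a [] = [a]"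
  | "thurston_output n a (b # bs) = perm_asymp n a b # thurston_output n (perm_bowtie n a b) bs"

lemma thurston_output_permutes:
  assumes "a permutes {1..n}" "\<forall>b\<in>set bs. b permutes {1..n}"
  shows "\<forall>p\<in>set (thurston_output n a bs). p permutes {1..n}"
  using assms
proof (induction bs arbitrary: a)
  case (Cons b bs)
  note ab = Cons.prems(1) bspec[OF Cons.prems(2) list.set_intros(1)]
  show ?case
    using Cons.IH[OF perm_bowtie_permutes[OF ab]] Cons.prems(2) perm_asymp_permutes[OF ab] by simp
qed simp

text \<open>
  The recursion suits the inductions that follow; the usual description of the output
  indexes its factors by their positions.
\<close>

lemma thurston_output_eq:
  assumes "a permutes {1..n}" "\<forall>b\<in>set bs. b permutes {1..n}"
  defines "B \<equiv> map (nr_braid n) bs"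
  defines "S \<equiv> (\<lambda>A i. foldl (th_bowtie n) A (take i B))"
  shows "map (nr_braid n) (thurston_output n a bs) =
    map (\<lambda>i. th_asymp n (S (nr_braid n a) i) (B ! i)) [0..<length B] @ [S (nr_braid n a) (length B)]"
  using assms(1,2) unfolding S_def B_def
proof (induction bs arbitrary: a)
  case (Cons b bs)
  note ab = Cons.prems(1) bspec[OF Cons.prems(2) list.set_intros(1)]
  have "[0..<length (map (nr_braid n) (b # bs))] = 0 # map Suc [0..<length (map (nr_braid n) bs)]"
    by (simp add: map_Suc_upt upt_conv_Cons del: upt_Suc)
  then show ?case
    using Cons.IH[OF perm_bowtie_permutes[OF ab]] Cons.prems(2)
    by (simp add: th_asymp_nr_braid[OF ab] th_bowtie_nr_braid[OF ab] o_def del: upt_Suc)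
qed simp

text \<open>
  The prefix \<open>Us\<close> collects the factors already produced; it has to be arbitrary for the induction.
\<close>

lemma thurston_output_steps:
  assumes "a permutes {1..n}" "\<forall>b\<in>set bs. b permutes {1..n}"
  shows "(thurston_step n)\<^sup>*\<^sup>* (Us @ nr_braid n a # map (nr_braid n) bs)
    (Us @ map (nr_braid n) (thurston_output n a bs))"
  using assms
proof (induction bs arbitrary: a Us)
  case (Cons b bs)
  note ab = Cons.prems(1) bspec[OF Cons.prems(2) list.set_intros(1)]
  have "thurston_step n (Us @ [nr_braid n a, nr_braid n b] @ map (nr_braid n) bs)
    (Us @ [th_asymp n (nr_braid n a) (nr_braid n b), th_bowtie n (nr_braid n a) (nr_braid n b)] @ map (nr_braid n) bs)"
    by (intro thurston_step.intros nr_braid_nonrepeating ab)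
  moreover have "(thurston_step n)\<^sup>*\<^sup>*
    ((Us @ [nr_braid n (perm_asymp n a b)]) @ nr_braid n (perm_bowtie n a b) # map (nr_braid n) bs)
    ((Us @ [nr_braid n (perm_asymp n a b)]) @ map (nr_braid n) (thurston_output n (perm_bowtie n a b) bs))"
    using Cons.prems(2) by (intro Cons.IH[OF perm_bowtie_permutes[OF ab]]) simp
  ultimately show ?case
    unfolding th_asymp_nr_braid[OF ab] th_bowtie_nr_braid[OF ab] by simp
qed simp

lemma thurston_output_braid:
  assumes "a permutes {1..n}" "\<forall>b\<in>set bs. b permutes {1..n}"
  shows "word_braid n (map (nr_braid n) (thurston_output n a bs)) =
    nr_braid n a \<otimes>\<^bsub>Br n\<^esub> word_braid n (map (nr_braid n) bs)"
  using assms
proof (induction bs arbitrary: a)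
  case (Cons b bs)
  note ab = Cons.prems(1) bspec[OF Cons.prems(2) list.set_intros(1)]
  note xy = perm_asymp_permutes[OF ab] perm_bowtie_permutes[OF ab]
  let ?W = "word_braid n (map (nr_braid n) bs)"
  have W: "?W \<in> carrier (Br n)"
    using Cons.prems(2) nr_braid_carrier[of _ n] by (intro word_braid_closed) auto
  have "word_braid n (map (nr_braid n) (thurston_output n a (b # bs))) =
      nr_braid n (perm_asymp n a b) \<otimes>\<^bsub>Br n\<^esub> (nr_braid n (perm_bowtie n a b) \<otimes>\<^bsub>Br n\<^esub> ?W)"
    using Cons.IH[OF xy(2)] Cons.prems(2) by (simp add: word_braid_def)
  also have "\<dots> = nr_braid n a \<otimes>\<^bsub>Br n\<^esub> (nr_braid n b \<otimes>\<^bsub>Br n\<^esub> ?W)"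
    unfolding Br_assoc[OF nr_braid_carrier nr_braid_carrier W, OF xy, symmetric]
      Br_assoc[OF nr_braid_carrier nr_braid_carrier W, OF ab, symmetric]
      nr_braid_mult_asymp_bowtie[OF ab] ..
  finally show ?case by (simp add: word_braid_def)
qed (simp add: word_braid_def)

text \<open>
  The last pair is greedy by maximality of the transfer, every other one by the domino rule.
\<close>

lemma thurston_output_normal:
  assumes "a permutes {1..n}" "\<forall>b\<in>set bs. b permutes {1..n}" "successively (normal_pair n) bs"
  shows "successively (normal_pair n) (thurston_output n a bs)"
  using assms
proof (induction bs arbitrary: a)
  case (Cons b bs)
  note ab = Cons.prems(1) bspec[OF Cons.prems(2) list.set_intros(1)]
  have IH: "successively (normal_pair n) (thurston_output n (perm_bowtie n a b) bs)"
    using Cons.IH[OF perm_bowtie_permutes[OF ab]] Cons.prems(2,3) by (cases bs) simp_all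
  show ?case
  proof (cases bs)
    case Nil
    then show ?thesis using normal_pair_asymp_bowtie[OF ab] by simp
  next
    case (Cons b' bs')
    then have "normal_pair n (perm_asymp n a b) (perm_asymp n (perm_bowtie n a b) b')"
      using Cons.prems by (intro domino_rule[OF ab]) auto
    then show ?thesis using IH Cons by simp
  qed
qed simp

theorem theorem4p1:
  fixes n :: nat and a :: "nat \<Rightarrow> nat" and bs :: "(nat \<Rightarrow> nat) list"
  assumes "n \<ge> 2"
    and "a permutes {1..n}"
    and "\<forall>b\<in>set bs. b permutes {1..n}"
    and "greedy_normal_form n (map (nr_braid n) bs)"
  shows "let A = nr_braid n a;
             B = map (nr_braid n) bs;
             l = length B;
             S = (\<lambda>i. foldl (th_bowtie n) A (take i B));
             W = map (\<lambda>i. th_asymp n (S i) (B ! i)) [0..<l] @ [S l]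
         in (thurston_step n)\<^sup>*\<^sup>* (A # B) W
            \<and> word_braid n W = A \<otimes>\<^bsub>Br n\<^esub> word_braid n B
            \<and> greedy_normal_form n W"
  unfolding Let_def thurston_output_eq[OF assms(2,3), symmetric]
proof (intro conjI)
  show "(thurston_step n)\<^sup>*\<^sup>* (nr_braid n a # map (nr_braid n) bs)
      (map (nr_braid n) (thurston_output n a bs))"
    using thurston_output_steps[OF assms(2,3), of "[]"] by simp
  show "word_braid n (map (nr_braid n) (thurston_output n a bs)) =
      nr_braid n a \<otimes>\<^bsub>Br n\<^esub> word_braid n (map (nr_braid n) bs)"
    by (rule thurston_output_braid[OF assms(2,3)])
  show "greedy_normal_form n (map (nr_braid n) (thurston_output n a bs))"
    using thurston_output_normal[OF assms(2,3)] assms(4)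
    unfolding greedy_normal_form_iff[OF thurston_output_permutes[OF assms(2,3)]]
      greedy_normal_form_iff[OF assms(3)] by blast
qed

end
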